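(* Let $M\ge 1$ be an integer, $N=2M+1$, let $\rho>0$ be a constant (the boundary is the circle of radius $\rho$), and let $R_0>0$. Let $S\in\mathbb R^{N\times(2M+1)}$ be the (square) modified Trefftz collocation matrix with parameters $M,\rho,R_0$. Then the condition number of $S$ in the 2-norm is $$\operatorname{cond}_2(S)=\begin{cases}\sqrt 2\left(\dfrac{\rho}{R_0}\right)^{M} & (R_0<\rho),\\[2mm] \sqrt 2\left(\dfrac{\rho}{R_0}\right) & (\rho\le R_0<2^{1/(2M)}\rho),\\[2mm] \left(\dfrac{R_0}{\rho}\right)^{M-1} & (2^{1/(2M)}\rho\le R_0<\sqrt2\,\rho),\\[2mm] \dfrac1{\sqrt2}\left(\dfrac{R_0}{\rho}\right)^{M} & (R_0\ge\sqrt 2\,\rho).\end{cases}$$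
   Context: Put $\theta_j=2\pi(j-1)/N$ for $j=1,\dots,N$. The modified Trefftz collocation matrix $S$ for the circular boundary of radius $\rho$ with characteristic length $R_0$ has entries $$S_{j,1}=1,\quad S_{j,2k}=\left(\frac{R_0}{\rho}\right)^k\cos k\theta_j,\quad S_{j,2k+1}=\left(\frac{R_0}{\rho}\right)^k\sin k\theta_j\qquad(j=1,\dots,N;\ k=1,\dots,M).$$ For an invertible matrix $Q$, $\operatorname{cond}_2(Q)=\|Q\|_2\|Q^{-1}\|_2$, where $\|Q\|_2$ is the largest singular value of $Q$. *)

theory Defs
  imports
    Complex_Main
    "Jordan_Normal_Form.Char_Poly"
    "Jordan_Normal_Form.Gauss_Jordan_Elimination"
begin

(* Only the values are recorded, without multiplicities.  For an m x n matrix with m < n the set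
   additionally contains 0, which does not affect the maximum. *)
definition singular_values :: "real mat \<Rightarrow> real set" where
  "singular_values Q = {sqrt l | l. eigenvalue (transpose_mat Q * Q) l}"

definition norm2_mat :: "real mat \<Rightarrow> real" where
  "norm2_mat Q = Max (singular_values Q)"

(* Meaningful for invertible Q only: otherwise the inverse is None and its content unspecified. *)
definition cond2 :: "real mat \<Rightarrow> real" where
  "cond2 Q = norm2_mat Q * norm2_mat (the (mat_inverse Q))"

(* Angle of the collocation point with 0-based index i, i.e. theta_{i+1} in 1-based counting. *)
definition colloc_angle :: "nat \<Rightarrow> nat \<Rightarrow> real" where
  "colloc_angle N i = 2 * pi * real i / real N"

(* Rows and columns are counted from 0, so the 1-based columns 1, 2k, 2k+1 are here the columns
   0, 2k-1, 2k.  An odd column c is the cosine column and an even column c > 0 the sine column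
   of order k = (c + 1) div 2. *)
definition modified_trefftz_mat :: "nat \<Rightarrow> nat \<Rightarrow> real \<Rightarrow> real \<Rightarrow> real mat" where
  "modified_trefftz_mat N M \<rho> R0 = mat N (2 * M + 1) (\<lambda>(i, c).
     let k = (c + 1) div 2 in
     if c = 0 then 1
     else if odd c then (R0 / \<rho>) ^ k * cos (real k * colloc_angle N i)
     else (R0 / \<rho>) ^ k * sin (real k * colloc_angle N i))"

end

(* The sampled trigonometric functions of order at most M are orthogonal on N = 2 * M + 1 equally
   spaced points, so S\<^sup>T S is diagonal and the singular values of S are sqrt N and
   sqrt (N / 2) * (R0 / \<rho>) ^ k for k = 1, ..., M.  The four cases are those of which of these is
   the largest and which is the smallest. *)
theory Submission
  imports Defs
begin

section \<open>Eigenvalues and singular values by diagonalisation\<close>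

lemma eigenvalue_mat_diag:
  fixes f :: "nat \<Rightarrow> 'a :: field"
  shows "eigenvalue (mat_diag n f) l \<longleftrightarrow> l \<in> f ` {..<n}"
proof -
  have ut: "upper_triangular (mat_diag n f)"
    by (auto simp: upper_triangular_def mat_diag_def)
  have "diag_mat (mat_diag n f) = map f [0..<n]"
    by (auto simp: diag_mat_def mat_diag_def)
  then have "char_poly (mat_diag n f) = (\<Prod>a\<leftarrow>map f [0..<n]. [:- a, 1:])"
    using char_poly_upper_triangular[OF mat_diag_dim ut] by simp
  then show ?thesis
    unfolding eigenvalue_root_char_poly[OF mat_diag_dim]
    by (auto simp: poly_prod_list prod_list_zero_iff)
qed

lemma eigenvalue_similar_mat:
  fixes A B :: "'a :: field mat"
  assumes "similar_mat A B"
  shows "eigenvalue A l \<longleftrightarrow> eigenvalue B l"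
proof -
  from similar_matD[OF assms] obtain n where "A \<in> carrier_mat n n" "B \<in> carrier_mat n n"
    by auto
  then show ?thesis
    using char_poly_similar[OF assms] eigenvalue_root_char_poly by metis
qed

text \<open>Similar matrices share their eigenvalues, and nonnegative \<open>w j\<close> are
  recovered from their squares by \<open>sqrt\<close>. Similarity instead of equality is assumed so
  that the same lemma serves the inverse matrix, whose Gram matrix is in general only similar to a
  diagonal one.\<close>

lemma singular_values_gram_similar_mat_diag:
  assumes "similar_mat (transpose_mat Q * Q) (mat_diag n (\<lambda>j. (w j)\<^sup>2))"
    and "\<And>j. j < n \<Longrightarrow> w j \<ge> 0"
  shows "singular_values Q = w ` {..<n}"
proof -
  have "singular_values Q = sqrt ` (\<lambda>j. (w j)\<^sup>2) ` {..<n}"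
    unfolding singular_values_def eigenvalue_similar_mat[OF assms(1)] eigenvalue_mat_diag
    by blast
  also have "\<dots> = w ` {..<n}"
    unfolding image_image using assms(2) by (intro image_cong) auto
  finally show ?thesis .
qed

section \<open>Condition number of a square matrix with orthogonal nonzero columns\<close>

context
  fixes Q :: "real mat" and n :: nat and w :: "nat \<Rightarrow> real"
  assumes Q: "Q \<in> carrier_mat n n"
    and gram: "transpose_mat Q * Q = mat_diag n (\<lambda>j. (w j)\<^sup>2)"
    and pos: "\<And>j. j < n \<Longrightarrow> w j > 0"
begin

text \<open>The candidate for the inverse: if D is the diagonal Gram matrix, multiplying it by its
  inverse gives the identity, so D^(-1) times the transpose of \<open>Q\<close> is a left inverse of
  \<open>Q\<close>.\<close>

private abbreviation "P \<equiv> mat_diag n (\<lambda>j. (1 / w j)\<^sup>2) * transpose_mat Q"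

private lemma diag_inverse:
  "mat_diag n (\<lambda>j. (1 / w j)\<^sup>2) * mat_diag n (\<lambda>j. (w j)\<^sup>2) = 1\<^sub>m n"
proof -
  have "mat_diag n (\<lambda>j. (1 / w j)\<^sup>2 * (w j)\<^sup>2) = (1\<^sub>m n :: real mat)"
    using pos by (intro eq_matI) (fastforce simp: mat_diag_def power_divide)+
  then show ?thesis by simp
qed

private lemma left_inverse: "P * Q = 1\<^sub>m n"
proof -
  have "P * Q = mat_diag n (\<lambda>j. (1 / w j)\<^sup>2) * (transpose_mat Q * Q)"
    using Q by (intro assoc_mult_mat[of _ n n _ n _ n]) auto
  then show ?thesis by (simp only: gram diag_inverse)
qed

private lemma P: "P \<in> carrier_mat n n"
  using Q by (intro mult_carrier_mat[of _ n n]) auto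

private lemma right_inverse: "Q * P = 1\<^sub>m n"
  by (rule mat_mult_left_right_inverse[OF P Q left_inverse])

lemma invertible_mat_diag_gram: "invertible_mat Q"
  unfolding invertible_mat_def inverts_mat_def
proof (intro conjI exI)
  show "square_mat Q" using Q by simp
  show "Q * P = 1\<^sub>m (dim_row Q)" using Q right_inverse by simp
  show "P * Q = 1\<^sub>m (dim_row P)" using carrier_matD(1)[OF P] left_inverse by simp
qed

text \<open>Since \<open>P\<close> makes \<open>Q\<close> a unit of the matrix ring,
  \<open>mat_inverse\<close> cannot fail; uniqueness of inverses then identifies its result with
  \<open>P\<close>.\<close>

private lemma mat_inverse_gram: "mat_inverse Q = Some P"
proof (cases "mat_inverse Q")
  case None
  have "Q \<in> Units (ring_mat TYPE(real) n ())"
    unfolding Units_def using P Q left_inverse right_inverse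
    by (auto simp: ring_mat_simps)
  with mat_inverse(1)[OF Q None, of "()"] show ?thesis by blast
next
  case (Some B)
  with mat_inverse(2)[OF Q] have B: "Q * B = 1\<^sub>m n" "B \<in> carrier_mat n n" by auto
  have "B = P * Q * B" using B by (simp add: left_inverse)
  also have "\<dots> = P * (Q * B)" by (rule assoc_mult_mat[OF P Q B(2)])
  also have "\<dots> = P" using right_mult_one_mat[OF P] by (simp only: B(1))
  finally show ?thesis using Some by simp
qed

lemma singular_values_diag_gram: "singular_values Q = w ` {..<n}"
  using pos by (intro singular_values_gram_similar_mat_diag)
    (auto simp: gram less_imp_le intro!: similar_mat_refl mat_diag_dim)

lemma singular_values_inverse_diag_gram:
  "singular_values (the (mat_inverse Q)) = (\<lambda>j. 1 / w j) ` {..<n}"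
proof -
  define D where "D = mat_diag n (\<lambda>j. (1 / w j)\<^sup>2)"
  have D: "D \<in> carrier_mat n n" "transpose_mat D = D"
    by (auto simp: D_def mat_diag_def)
  have QT: "transpose_mat Q \<in> carrier_mat n n" using Q by auto
  have "transpose_mat (D * transpose_mat Q) = Q * D"
    using transpose_mult[OF D(1) QT] D(2) by simp
  \<comment> \<open>With \<open>P\<close> = D Q^T and symmetric D, the Gram matrix P^T P equals Q D
    P, which is the conjugate of D by \<open>Q\<close> because \<open>P\<close> is the inverse of
    \<open>Q\<close>.\<close>
  then have "similar_mat (transpose_mat (D * transpose_mat Q) * (D * transpose_mat Q)) D"
    using left_inverse right_inverse D Q P unfolding D_def[symmetric]
    by (intro similar_matI[where P = Q and Q = "D * transpose_mat Q" and n = n]) auto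
  then show ?thesis
    using pos unfolding mat_inverse_gram D_def
    by (intro singular_values_gram_similar_mat_diag) (auto simp: less_imp_le)
qed

text \<open>Taking reciprocals reverses the order, so the smallest \<open>w b\<close> yields the
  norm of the inverse. With the extremal indices as parameters, each case of the theorem only has to
  name two columns.\<close>

lemma cond2_diag_gram:
  assumes a: "a < n" "\<And>j. j < n \<Longrightarrow> w j \<le> w a" and b: "b < n" "\<And>j. j < n \<Longrightarrow> w b \<le> w j"
  shows "cond2 Q = w a / w b"
proof -
  have "Max (w ` {..<n}) = w a" using a by (intro Max_eqI) auto
  moreover have "Max ((\<lambda>j. 1 / w j) ` {..<n}) = 1 / w b"
    using b pos[OF b(1)] by (intro Max_eqI) (auto intro!: divide_left_mono mult_pos_pos pos)
  ultimately show ?thesis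
    by (simp add: cond2_def norm2_mat_def singular_values_diag_gram
        singular_values_inverse_diag_gram)
qed

end

section \<open>Discrete orthogonality of the trigonometric functions\<close>

lemma sum_cis_colloc_angle_eq_0:
  fixes m :: int
  assumes "N > 0" and "\<not> int N dvd m"
  shows "(\<Sum>i<N. cis (of_int m * colloc_angle N i)) = 0"
proof -
  \<comment> \<open>The sum is geometric with ratio \<open>z\<close>, an \<open>N\<close>-th root of
    unity. It vanishes as soon as \<open>z\<close> differs from 1, which is what non-divisibility
    guarantees.\<close>
  define z where "z = cis (2 * pi * of_int m / of_nat N)"
  have eq: "cis (of_int m * colloc_angle N i) = z ^ i" for i
    unfolding z_def DeMoivre colloc_angle_def by (simp add: field_simps)
  have "z ^ N = cis (2 * pi * of_int m)"
    unfolding z_def DeMoivre using assms(1) by (simp add: field_simps)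
  then have zN: "z ^ N = 1" by simp
  have "z \<noteq> 1"
  proof
    assume "z = 1"
    then have "cos (2 * pi * of_int m / of_nat N) = 1"
      by (simp add: z_def complex_eq_iff)
    then obtain q :: int where "2 * pi * of_int m / of_nat N = of_int q * 2 * pi"
      unfolding cos_one_2pi_int by blast
    then have "real_of_int m = real_of_int (q * int N)"
      using assms(1) by (simp add: field_simps)
    then have "m = q * int N" unfolding of_int_eq_iff .
    then show False using assms(2) by simp
  qed
  then show ?thesis unfolding eq using geometric_sum[of z N] zN by simp
qed

text \<open>Real part of the geometric sum: in the range \<bar>m\<bar> < N the only multiple of
  \<open>N\<close> is 0. The frequency is an integer because differences of orders can be
  negative.\<close>

lemma sum_cos_colloc_angle:
  fixes m :: int
  assumes "\<bar>m\<bar> < int N"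
  shows "(\<Sum>i<N. cos (of_int m * colloc_angle N i)) = (if m = 0 then real N else 0)"
proof (cases "m = 0")
  case False
  then have "\<not> int N dvd m" using assms zdvd_imp_le[of "int N" "\<bar>m\<bar>"] by auto
  then have "Re (\<Sum>i<N. cis (of_int m * colloc_angle N i)) = 0"
    using sum_cis_colloc_angle_eq_0[of N m] assms by simp
  then show ?thesis using False by simp
qed simp

lemma sum_sin_colloc_angle:
  fixes m :: int
  assumes "\<bar>m\<bar> < int N"
  shows "(\<Sum>i<N. sin (of_int m * colloc_angle N i)) = 0"
proof (cases "m = 0")
  case False
  then have "\<not> int N dvd m" using assms zdvd_imp_le[of "int N" "\<bar>m\<bar>"] by auto
  then have "Im (\<Sum>i<N. cis (of_int m * colloc_angle N i)) = 0"
    using sum_cis_colloc_angle_eq_0[of N m] assms by simp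
  then show ?thesis by simp
qed simp

context
  fixes N k l :: nat
  assumes kl: "k + l < N"
begin

private lemma bounds: "\<bar>int k - int l\<bar> < int N" "\<bar>int k + int l\<bar> < int N"
  using kl by auto

text \<open>The product formula splits the summand into frequencies k - l and k + l, each with
  weight 1/2. Both vanish if k = l = 0, which gives \<open>N\<close>; only the difference vanishes
  if k = l > 0, which gives half of that.\<close>

lemma sum_cos_cos_colloc_angle:
  "(\<Sum>i<N. cos (real k * colloc_angle N i) * cos (real l * colloc_angle N i)) =
     (if k = l then if k = 0 then real N else real N / 2 else 0)"
  using sum_cos_colloc_angle[OF bounds(1)] sum_cos_colloc_angle[OF bounds(2)]
  by (auto simp: cos_times_cos sum.distrib left_diff_distrib distrib_right
      simp flip: sum_divide_distrib)

lemma sum_sin_sin_colloc_angle: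
  "(\<Sum>i<N. sin (real k * colloc_angle N i) * sin (real l * colloc_angle N i)) =
     (if k = l \<and> k \<noteq> 0 then real N / 2 else 0)"
  using sum_cos_colloc_angle[OF bounds(1)] sum_cos_colloc_angle[OF bounds(2)]
  by (auto simp: sin_times_sin sum_subtractf left_diff_distrib distrib_right
      simp flip: sum_divide_distrib)

lemma sum_sin_cos_colloc_angle:
  "(\<Sum>i<N. sin (real k * colloc_angle N i) * cos (real l * colloc_angle N i)) = 0"
  using sum_sin_colloc_angle[OF bounds(1)] sum_sin_colloc_angle[OF bounds(2)]
  by (auto simp: sin_times_cos sum.distrib left_diff_distrib distrib_right
      simp flip: sum_divide_distrib)

end

section \<open>The Gram matrix of the collocation matrix\<close>

text \<open>Indexed by the column, so that each order k > 0 occurs twice, once for the cosine and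
  once for the sine. For N = 2M + 1, c < N and r = R0/\<rho> > 0 it is the Euclidean norm of column
  \<open>c\<close>.\<close>

definition trefftz_singular_value :: "nat \<Rightarrow> real \<Rightarrow> nat \<Rightarrow> real" where
  "trefftz_singular_value N r c =
     sqrt (real N) * (if c = 0 then 1 else r ^ ((c + 1) div 2) / sqrt 2)"

lemma gram_modified_trefftz_mat:
  assumes N: "N = 2 * M + 1"
  shows "transpose_mat (modified_trefftz_mat N M \<rho> R0) * modified_trefftz_mat N M \<rho> R0 =
    mat_diag N (\<lambda>c. (trefftz_singular_value N (R0 / \<rho>) c)\<^sup>2)"
proof -
  define S where "S = modified_trefftz_mat N M \<rho> R0"
  define r where "r = R0 / \<rho>"
  define k :: "nat \<Rightarrow> nat" where "k c = (c + 1) div 2" for c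
  \<comment> \<open>Column 0 counts as the cosine of order 0, which leaves two families of columns
    instead of three.\<close>
  define t where "t c i = (if even c \<and> c \<noteq> 0 then sin (real (k c) * colloc_angle N i)
    else cos (real (k c) * colloc_angle N i))" for c i
  have dims: "dim_row S = N" "dim_col S = N"
    using N by (auto simp: S_def modified_trefftz_mat_def)
  have entry: "S $$ (i, c) = r ^ k c * t c i" if "i < N" "c < N" for i c
    using that N by (auto simp: S_def modified_trefftz_mat_def Let_def r_def k_def t_def)
  have orth: "(\<Sum>i<N. t c i * t d i) =
      (if c = d then if c = 0 then real N else real N / 2 else 0)" if "c < N" "d < N" for c d
  proof -
    \<comment> \<open>Each order is at most \<open>M\<close>, so two of them add up to at most 2M =
      N - 1; this keeps the sum of two frequencies from reaching \<open>N\<close>.\<close>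
    have kl: "k c + k d < N" using that N unfolding k_def by presburger
    have kl': "k d + k c < N" using kl by simp
    show ?thesis
    proof (cases "even c \<and> c \<noteq> 0"; cases "even d \<and> d \<noteq> 0")
      assume c: "even c \<and> c \<noteq> 0" and d: "even d \<and> d \<noteq> 0"
      have "k c = k d \<and> k c \<noteq> 0 \<longleftrightarrow> c = d" using c d unfolding k_def by presburger
      then show ?thesis
        using c sum_sin_sin_colloc_angle[OF kl] unfolding t_def if_P[OF c] if_P[OF d] by simp
    next
      assume c: "even c \<and> c \<noteq> 0" and d: "\<not> (even d \<and> d \<noteq> 0)"
      then have "c \<noteq> d" by blast
      then show ?thesis
        using sum_sin_cos_colloc_angle[OF kl] unfolding t_def if_P[OF c] if_not_P[OF d] by simp
    next
      assume c: "\<not> (even c \<and> c \<noteq> 0)" and d: "even d \<and> d \<noteq> 0"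
      then have "c \<noteq> d" by blast
      then show ?thesis
        using sum_sin_cos_colloc_angle[OF kl'] unfolding t_def if_not_P[OF c] if_P[OF d]
        by (simp add: mult.commute)
    next
      assume c: "\<not> (even c \<and> c \<noteq> 0)" and d: "\<not> (even d \<and> d \<noteq> 0)"
      \<comment> \<open>Within the cosine family the order determines the column, so orthogonality
        in terms of orders becomes orthogonality in terms of columns.\<close>
      have k: "k c = k d \<longleftrightarrow> c = d" "k c = 0 \<longleftrightarrow> c = 0" using c d unfolding k_def by presburger+
      show ?thesis
        using sum_cos_cos_colloc_angle[OF kl] unfolding t_def if_not_P[OF c] if_not_P[OF d] k .
    qed
  qed
  show ?thesis
    unfolding S_def[symmetric] r_def[symmetric]
  proof (intro eq_matI)
    fix c d
    assume "c < dim_row (mat_diag N (\<lambda>c. (trefftz_singular_value N r c)\<^sup>2))"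
      "d < dim_col (mat_diag N (\<lambda>c. (trefftz_singular_value N r c)\<^sup>2))"
    then have cd: "c < N" "d < N" by (auto simp: mat_diag_def)
    have "(transpose_mat S * S) $$ (c, d) = (\<Sum>i<N. S $$ (i, c) * S $$ (i, d))"
      using cd dims by (simp add: scalar_prod_def atLeast0LessThan)
    also have "\<dots> = (\<Sum>i<N. r ^ k c * r ^ k d * (t c i * t d i))"
      using cd by (intro sum.cong) (auto simp: entry)
    also have "\<dots> = r ^ k c * r ^ k d * (\<Sum>i<N. t c i * t d i)"
      by (simp add: sum_distrib_left)
    also have "\<dots> = mat_diag N (\<lambda>c. (trefftz_singular_value N r c)\<^sup>2) $$ (c, d)"
      unfolding orth[OF cd] using cd
      by (auto simp: mat_diag_def trefftz_singular_value_def k_def power_divide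
          power_mult_distrib power2_eq_square)
    finally show "(transpose_mat S * S) $$ (c, d) = \<dots>" .
  qed (use dims in \<open>auto simp: mat_diag_def\<close>)
qed

section \<open>Comparison of the singular values and the four cases\<close>

lemma powr_half_inverse_power:
  assumes "M \<ge> 1"
  shows "(2 powr (1 / (2 * real M))) ^ M = sqrt 2"
  using assms by (simp add: powr_powr powr_half_sqrt flip: powr_realpow)

theorem theorem1:
  fixes M N :: nat and \<rho> R0 :: real and S :: "real mat"
  assumes "M \<ge> 1" and "N = 2 * M + 1" and "\<rho> > 0" and "R0 > 0"
    and "S = modified_trefftz_mat N M \<rho> R0"
  shows "invertible_mat S \<and>
    (R0 < \<rho> \<longrightarrow> cond2 S = sqrt 2 * (\<rho> / R0) ^ M) \<and>
    (\<rho> \<le> R0 \<and> R0 < 2 powr (1 / (2 * real M)) * \<rho> \<longrightarrow> cond2 S = sqrt 2 * (\<rho> / R0)) \<and>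
    (2 powr (1 / (2 * real M)) * \<rho> \<le> R0 \<and> R0 < sqrt 2 * \<rho> \<longrightarrow> cond2 S = (R0 / \<rho>) ^ (M - 1)) \<and>
    (R0 \<ge> sqrt 2 * \<rho> \<longrightarrow> cond2 S = 1 / sqrt 2 * (R0 / \<rho>) ^ M)"
proof -
  define r where "r = R0 / \<rho>"
  \<comment> \<open>The value of \<open>r\<close> at which r^M = \<open>sqrt 2\<close>, that is,
    where the singular value of order \<open>M\<close> draws level with that of the constant
    column.\<close>
  define p :: real where "p = 2 powr (1 / (2 * real M))"
  \<comment> \<open>The singular values without the common factor \<open>sqrt (real N)\<close>,
    which cancels in the condition number.\<close>
  define v where "v c = (if c = 0 then 1 else r ^ ((c + 1) div 2) / sqrt 2)" for c :: nat
  let ?w = "trefftz_singular_value N r"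
  have w: "?w c = sqrt (real N) * v c" for c
    by (simp add: trefftz_singular_value_def v_def)
  have N: "N > 0" and r: "r > 0" using assms by (auto simp: r_def)
  have S: "S \<in> carrier_mat N N" using assms by (auto simp: modified_trefftz_mat_def)
  have gram: "transpose_mat S * S = mat_diag N (\<lambda>c. (?w c)\<^sup>2)"
    using gram_modified_trefftz_mat[OF assms(2)] assms(5) by (simp add: r_def)
  have pos: "?w c > 0" for c using N r by (simp add: w v_def)
  have cond: "cond2 S = v a / v b"
    if "a < N" "b < N" "\<And>c. c < N \<Longrightarrow> v c \<le> v a \<and> v b \<le> v c" for a b
    using cond2_diag_gram[OF S gram pos, of a b] that N by (simp add: w mult_left_mono)
  have v0: "v 0 = 1" and v1: "v 1 = r / sqrt 2" and vM: "v (2 * M) = r ^ M / sqrt 2"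
    using assms(1) by (auto simp: v_def)
  have less_N: "0 < N" "1 < N" "2 * M < N" using assms by auto
  have v_cases: "v c = 1 \<or> (\<exists>k. 1 \<le> k \<and> k \<le> M \<and> v c = r ^ k / sqrt 2)" if "c < N" for c
    using that assms(2) by (cases "c = 0") (auto simp: v_def intro!: exI[of _ "(c + 1) div 2"])
  \<comment> \<open>For r < 1 the powers decay, so the constant column is on top and order
    \<open>M\<close> at the bottom.\<close>
  have le1: "v c \<le> v 0 \<and> v (2 * M) \<le> v c" if "r < 1" "c < N" for c
  proof -
    have decay: "r ^ k / sqrt 2 \<le> 1" "r ^ M / sqrt 2 \<le> r ^ k / sqrt 2" if "k \<le> M" for k
    proof -
      have "r ^ k \<le> sqrt 2"
        using order_trans[OF power_le_one real_sqrt_ge_one[of 2], of r k] \<open>r < 1\<close> r by simp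
      then show "r ^ k / sqrt 2 \<le> 1" by simp
      show "r ^ M / sqrt 2 \<le> r ^ k / sqrt 2"
        using \<open>r < 1\<close> r that by (intro divide_right_mono power_decreasing) auto
    qed
    from v_cases[OF \<open>c < N\<close>] show ?thesis
      unfolding v0 vM using decay decay(1)[OF le_refl] by (elim disjE exE conjE) simp_all
  qed
  \<comment> \<open>For r \<ge> 1 the values of positive order lie between those of orders 1 and
    \<open>M\<close>. What remains is the position of 1, the value of the constant column: above
    both in \<open>le2\<close>, between them in \<open>le3\<close>, below both in
    \<open>le4\<close>.\<close>
  have grow: "r / sqrt 2 \<le> r ^ k / sqrt 2" "r ^ k / sqrt 2 \<le> r ^ M / sqrt 2"
    if "r \<ge> 1" "1 \<le> k" "k \<le> M" for k
    using that power_increasing[of 1 k r] power_increasing[of k M r]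
    by (auto intro: divide_right_mono)
  have le2: "v c \<le> v 0 \<and> v 1 \<le> v c" if "r \<ge> 1" "r ^ M \<le> sqrt 2" "c < N" for c
  proof -
    have "r ^ M / sqrt 2 \<le> 1" using that by simp
    then show ?thesis
      using v_cases[OF \<open>c < N\<close>] grow[OF \<open>r \<ge> 1\<close>] assms(1) unfolding v0 v1
      by (smt (verit, best) le_refl)
  qed
  have le3: "v c \<le> v (2 * M) \<and> v 1 \<le> v c"
    if "r \<ge> 1" "sqrt 2 \<le> r ^ M" "r \<le> sqrt 2" "c < N" for c
  proof -
    have "1 \<le> r ^ M / sqrt 2" "r / sqrt 2 \<le> 1" using that by auto
    then show ?thesis
      using v_cases[OF \<open>c < N\<close>] grow[OF \<open>r \<ge> 1\<close>] unfolding vM v1 by auto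
  qed
  have le4: "v c \<le> v (2 * M) \<and> v 0 \<le> v c" if "sqrt 2 \<le> r" "c < N" for c
  proof -
    have r1: "r \<ge> 1" using that(1) real_sqrt_ge_one[of 2] by linarith
    have "1 \<le> r / sqrt 2" using that by auto
    then show ?thesis
      using v_cases[OF \<open>c < N\<close>] grow[OF r1] assms(1) unfolding v0 vM
      by (smt (verit, best) le_refl)
  qed
  have p: "p > 0" "p ^ M = sqrt 2"
    using powr_half_inverse_power[OF assms(1)] by (auto simp: p_def)
  have p1: "p \<ge> 1" by (simp add: p_def ge_one_powr_ge_zero)
  have r_iff: "R0 < x * \<rho> \<longleftrightarrow> r < x" "x * \<rho> \<le> R0 \<longleftrightarrow> x \<le> r" for x
    using assms(3) by (auto simp: r_def field_simps)
  have r_iff1: "R0 < \<rho> \<longleftrightarrow> r < 1" "\<rho> \<le> R0 \<longleftrightarrow> 1 \<le> r" using r_iff[of 1] by auto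
  have inv: "\<rho> / R0 = 1 / r" by (simp add: r_def)
  have "cond2 S = sqrt 2 * (1 / r) ^ M" if "r < 1"
    using cond[OF less_N(1) less_N(3) le1[OF that]] r by (simp add: v0 vM power_divide)
  moreover have "cond2 S = sqrt 2 * (1 / r)" if "1 \<le> r" "r < p"
  proof -
    have "r ^ M \<le> sqrt 2" using power_mono[of r p M] that r p(2) by simp
    from cond[OF less_N(1) less_N(2) le2[OF that(1) this]] show ?thesis
      using v0 v1 by simp
  qed
  moreover have "cond2 S = r ^ (M - 1)" if "p \<le> r" "r < sqrt 2"
  proof -
    \<comment> \<open>Monotonicity of the \<open>M\<close>-th power turns p \<le> r into
      \<open>sqrt 2\<close> = p^M \<le> r^M. The extremal columns then have orders \<open>M\<close>
      and 1, and the factors \<open>sqrt 2\<close> cancel in their quotient.\<close>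
    have "r \<ge> 1" "sqrt 2 \<le> r ^ M" "r \<le> sqrt 2"
      using power_mono[of p r M] that p p1 by auto
    from cond[OF less_N(3) less_N(2) le3[OF this]] have "cond2 S = r ^ M / r"
      using v1 vM by simp
    then show ?thesis using r assms(1) by (simp add: power_diff)
  qed
  moreover have "cond2 S = 1 / sqrt 2 * r ^ M" if "sqrt 2 \<le> r"
    using cond[OF less_N(3) less_N(1) le4[OF that]] v0 vM by simp
  ultimately show ?thesis
    using invertible_mat_diag_gram[OF S gram pos]
    unfolding r_iff r_iff1 inv p_def[symmetric] r_def[symmetric] by blast
qed

end
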